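(* Let $0<\mu\le L$ and let $f:\mathbb{R}^d\to\mathbb{R}$ be continuously differentiable, $L$-smooth and $\mu$-strongly convex, with minimizer $x^*$ and $f^*=f(x^* )$. Let $\alpha\in[0,1)$ satisfy $$\alpha<\frac{\sqrt2-1}{18\sqrt2}\sqrt{\frac{\mu}{L}},$$ and let $\widetilde\nabla f:\mathbb{R}^d\to\mathbb{R}^d$ satisfy $\|\widetilde\nabla f(x)-\nabla f(x)\|_2\le\alpha\|\nabla f(x)\|_2$ for all $x\in\mathbb{R}^d$. Let $x^0\in\mathbb{R}^d$, $R=\|x^0-x^*\|_2$. Then for every $N\ge 0$ the point $x^N$ generated by RE-AGM with parameters $(L,\frac{\mu}{2},x^0,\alpha)$ satisfies $$f(x^N)-f^*\le L R^2\left(1-\frac{1}{10\sqrt2}\sqrt{\frac{\mu}{L}}\right)^N .$$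
   Context: $f$ is $L$-smooth and $\mu$-strongly convex if for all $x,y\in\mathbb{R}^d$: $\frac{\mu}{2}\|y-x\|_2^2\le f(y)-f(x)-\langle\nabla f(x),y-x\rangle\le\frac{L}{2}\|y-x\|_2^2$. RE-AGM (Relative Error Accelerated Gradient Method) with parameters $(L,\bar\mu,x_{\rm start},\alpha)$ (in the claim $\bar\mu=\mu/2$, $x_{\rm start}=x^0$): set $h=\frac1L\left(\frac{1-\alpha}{1+\alpha}\right)^{3/2}$, $\widehat L=\frac{L(1+\alpha)}{(1-\alpha)^3}$, $x^0=u^0=x_{\rm start}$, $s=1+2\alpha+2\alpha^2$, $m=1-2\alpha$, $q=\bar\mu/\widehat L$. For $k=0,1,2,\dots$ let $a_k=\frac{(m-s)+\sqrt{(s-m)^2+4mq}}{2m}$ (the largest root of $m a^2+(s-m)a-q=0$; it does not depend on $k$), and $$y^k=\frac{a_ku^k+x^k}{1+a_k},\quad u^{k+1}=(1-a_k)u^k+a_ky^k-\frac{a_k}{\bar\mu}\widetilde\nabla f(y^k),\quad x^{k+1}=y^k-h\widetilde\nabla f(y^k).$$ *)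

theory Defs
  imports "HOL-Analysis.Analysis"
begin

definition has_continuous_gradient :: "('a::real_inner \<Rightarrow> real) \<Rightarrow> ('a \<Rightarrow> 'a) \<Rightarrow> bool" where
  "has_continuous_gradient f gradf \<longleftrightarrow>
     (\<forall>x. GDERIV f x :> gradf x) \<and> continuous_on UNIV gradf"

definition smooth_strongly_convex ::
    "real \<Rightarrow> real \<Rightarrow> ('a::real_inner \<Rightarrow> real) \<Rightarrow> ('a \<Rightarrow> 'a) \<Rightarrow> bool" where
  "smooth_strongly_convex L \<mu> f gradf \<longleftrightarrow>
     (\<forall>x y. \<mu> / 2 * (norm (y - x))\<^sup>2 \<le> f y - f x - gradf x \<bullet> (y - x) \<and>
            f y - f x - gradf x \<bullet> (y - x) \<le> L / 2 * (norm (y - x))\<^sup>2)"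

definition relative_error_gradient :: "real \<Rightarrow> ('a::real_normed_vector \<Rightarrow> 'a) \<Rightarrow> ('a \<Rightarrow> 'a) \<Rightarrow> bool" where
  "relative_error_gradient \<alpha> gradf G \<longleftrightarrow> (\<forall>x. norm (G x - gradf x) \<le> \<alpha> * norm (gradf x))"

definition re_agm_h :: "real \<Rightarrow> real \<Rightarrow> real" where
  "re_agm_h L \<alpha> = 1 / L * ((1 - \<alpha>) / (1 + \<alpha>)) powr (3 / 2)"

definition re_agm_Lhat :: "real \<Rightarrow> real \<Rightarrow> real" where
  "re_agm_Lhat L \<alpha> = L * (1 + \<alpha>) / (1 - \<alpha>) ^ 3"

text \<open>The largest root of \<open>m a\<^sup>2 + (s - m) a - q = 0\<close>; the same value is used in every step.\<close>

definition re_agm_a :: "real \<Rightarrow> real \<Rightarrow> real \<Rightarrow> real" where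
  "re_agm_a L \<mu>bar \<alpha> =
     (let s = 1 + 2 * \<alpha> + 2 * \<alpha>\<^sup>2;
          m = 1 - 2 * \<alpha>;
          q = \<mu>bar / re_agm_Lhat L \<alpha>
      in ((m - s) + sqrt ((s - m)\<^sup>2 + 4 * m * q)) / (2 * m))"

text \<open>One step maps \<open>(x\<^sup>k, u\<^sup>k)\<close> to \<open>(x\<^sup>k\<^sup>+\<^sup>1, u\<^sup>k\<^sup>+\<^sup>1)\<close>; the point \<open>y\<^sup>k\<close> is local to the step.
  \<open>G\<close> is the inexact gradient oracle.\<close>

definition re_agm_step ::
    "real \<Rightarrow> real \<Rightarrow> real \<Rightarrow> ('a::real_vector \<Rightarrow> 'a) \<Rightarrow> 'a \<times> 'a \<Rightarrow> 'a \<times> 'a" where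
  "re_agm_step L \<mu>bar \<alpha> G = (\<lambda>(x, u).
     let a = re_agm_a L \<mu>bar \<alpha>;
         y = (a *\<^sub>R u + x) /\<^sub>R (1 + a)
     in (y - re_agm_h L \<alpha> *\<^sub>R G y,
         (1 - a) *\<^sub>R u + a *\<^sub>R y - (a / \<mu>bar) *\<^sub>R G y))"

primrec re_agm ::
    "real \<Rightarrow> real \<Rightarrow> 'a::real_vector \<Rightarrow> real \<Rightarrow> ('a \<Rightarrow> 'a) \<Rightarrow> nat \<Rightarrow> 'a \<times> 'a" where
  "re_agm L \<mu>bar xstart \<alpha> G 0 = (xstart, xstart)"
| "re_agm L \<mu>bar xstart \<alpha> G (Suc k) = re_agm_step L \<mu>bar \<alpha> G (re_agm L \<mu>bar xstart \<alpha> G k)"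

definition re_agm_x ::
    "real \<Rightarrow> real \<Rightarrow> 'a::real_vector \<Rightarrow> real \<Rightarrow> ('a \<Rightarrow> 'a) \<Rightarrow> nat \<Rightarrow> 'a" where
  "re_agm_x L \<mu>bar xstart \<alpha> G k = fst (re_agm L \<mu>bar xstart \<alpha> G k)"

end

theory Submission
  imports Defs
begin

text \<open>
  The energy \<open>V k = f (x k) - f xstar + \<mu>/4 * |u k - xstar|\<^sup>2\<close> contracts by the factor \<open>1 - a\<close> in every
  step.  Running the method with \<open>\<mu>/2\<close> in place of \<open>\<mu>\<close> leaves unused quadratic terms in
  \<open>y k - xstar\<close> and \<open>u k - y k\<close>, and these absorb the inner products with the gradient error by
  AM-GM, at the price of \<open>2 a \<alpha>\<^sup>2/\<mu> * |gradf (y k)|\<^sup>2\<close>.  By the quadratic equation for \<open>a\<close>,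
  the decrease of \<open>f\<close> along the gradient step pays for this and for the \<open>|G (y k)|\<^sup>2\<close> term as soon as
  \<open>a (4 + \<alpha>) \<le> 4\<close>.
\<close>

section \<open>Vanishing gradient at the minimizer and AM-GM for the gradient error\<close>

text \<open>By the upper quadratic bound, a step of length \<open>1 / L\<close> against the gradient
  lowers \<open>f\<close> by at least \<open>(norm (gradf z))\<^sup>2 / (2 * L)\<close>, which
  minimality forbids unless the gradient vanishes.\<close>

lemma gradient_zero_at_minimizer:
  assumes "0 < L" "smooth_strongly_convex L \<mu> f gradf" "\<forall>x. f z \<le> f x"
  shows "gradf z = 0"
proof -
  define y where "y = z - (1 / L) *\<^sub>R gradf z"
  define K where "K = (norm (gradf z))\<^sup>2 / L"
  have "f y - f z - gradf z \<bullet> (y - z) \<le> L / 2 * (norm (y - z))\<^sup>2"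
    using assms(2) unfolding smooth_strongly_convex_def by blast
  moreover have "gradf z \<bullet> (y - z) = - K"
    by (simp add: y_def K_def power2_norm_eq_inner)
  moreover have "L / 2 * (norm (y - z))\<^sup>2 = K / 2"
    using assms(1) by (simp add: y_def K_def power2_eq_square)
  moreover have "f z \<le> f y" using assms(3) by blast
  ultimately have "K \<le> 0" by linarith
  then show ?thesis using assms(1) by (simp add: K_def divide_le_0_iff)
qed

text \<open>Cauchy-Schwarz followed by AM-GM. The weight \<open>\<mu> / 4\<close> is the one that
  the spare quadratic terms in the energy estimate can absorb exactly.\<close>

lemma inner_error_bound:
  fixes e w :: "'a::real_inner"
  assumes "0 < \<mu>" "norm e \<le> \<alpha> * n"
  shows "- (e \<bullet> w) \<le> \<mu> / 4 * (norm w)\<^sup>2 + \<alpha>\<^sup>2 / \<mu> * n\<^sup>2"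
proof -
  have "- (e \<bullet> w) \<le> norm e * norm w"
    using Cauchy_Schwarz_ineq2[of e w] by linarith
  also have "\<dots> \<le> (\<alpha> * n) * norm w"
    using assms(2) by (simp add: mult_right_mono)
  also have "\<dots> \<le> \<mu> / 4 * (norm w)\<^sup>2 + \<alpha>\<^sup>2 / \<mu> * n\<^sup>2"
  proof -
    have "0 \<le> (\<mu> / 2 * norm w - \<alpha> * n)\<^sup>2 / \<mu>" using assms(1) by simp
    also have "\<dots> = \<mu> / 4 * (norm w)\<^sup>2 + \<alpha>\<^sup>2 / \<mu> * n\<^sup>2 - (\<alpha> * n) * norm w"
      using assms(1) by (simp add: field_simps power2_eq_square)
    finally show ?thesis by simp
  qed
  finally show ?thesis .
qed

section \<open>Decrease of \<open>f\<close> along the inexact gradient step\<close>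

text \<open>With \<open>\<rho> = (1 - \<alpha>) / (1 + \<alpha>)\<close> in (0,1],
  \<open>L * h\<close> is \<rho> to the power 3/2, and this exponent lies between 0 and 2. Bounding
  by an integer power removes \<open>powr\<close> from later estimates.\<close>

lemma re_agm_h_bounds:
  assumes "0 < L" "0 \<le> \<alpha>" "\<alpha> < 1"
  shows "((1 - \<alpha>) / (1 + \<alpha>))\<^sup>2 \<le> L * re_agm_h L \<alpha>" "L * re_agm_h L \<alpha> \<le> 1"
proof -
  define \<rho> where "\<rho> = (1 - \<alpha>) / (1 + \<alpha>)"
  have r: "0 < \<rho>" "\<rho> \<le> 1" using assms by (auto simp: \<rho>_def)
  have e: "L * re_agm_h L \<alpha> = \<rho> powr (3 / 2)"
    using assms by (simp add: re_agm_h_def \<rho>_def)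
  have "\<rho>\<^sup>2 = \<rho> powr 2" using r by simp
  also have "\<dots> \<le> \<rho> powr (3 / 2)" by (rule powr_mono') (use r in auto)
  finally show "((1 - \<alpha>) / (1 + \<alpha>))\<^sup>2 \<le> L * re_agm_h L \<alpha>" by (simp add: e \<rho>_def)
  show "L * re_agm_h L \<alpha> \<le> 1"
    unfolding e using r by (simp add: powr_le1)
qed

lemma inexact_gradient_step_decrease:
  assumes L: "0 < L" and a: "0 \<le> \<alpha>" "\<alpha> < 1"
    and f: "smooth_strongly_convex L \<mu> f gradf" and G: "relative_error_gradient \<alpha> gradf G"
  shows "f (y - re_agm_h L \<alpha> *\<^sub>R G y) \<le> f y - (norm (gradf y))\<^sup>2 / (2 * re_agm_Lhat L \<alpha>)"
proof -
  define h where "h = re_agm_h L \<alpha>"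
  define g where "g = gradf y"
  note hb = re_agm_h_bounds[OF L a, folded h_def]
  have h0: "0 \<le> h" using L a by (simp add: h_def re_agm_h_def)
  have "f (y - h *\<^sub>R G y) - f y - g \<bullet> ((y - h *\<^sub>R G y) - y) \<le> L / 2 * (norm ((y - h *\<^sub>R G y) - y))\<^sup>2"
    using f unfolding smooth_strongly_convex_def g_def by blast
  then have 1: "f (y - h *\<^sub>R G y) \<le> f y - h * (g \<bullet> G y) + L / 2 * h\<^sup>2 * (norm (G y))\<^sup>2"
    by (simp add: power_mult_distrib)
  have "norm (G y - g) \<le> \<alpha> * norm g"
    using G unfolding relative_error_gradient_def g_def by blast
  then have "(norm (G y - g))\<^sup>2 \<le> \<alpha>\<^sup>2 * (norm g)\<^sup>2"
    by (metis norm_ge_zero power_mono power_mult_distrib)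
  \<comment> \<open>The square is expanded and the term \<open>(norm (G y))\<^sup>2\<close> is kept:
    since \<open>L * h \<le> 1\<close>, it cancels the second-order term of
    \<open>1\<close>.\<close>
  then have "(1 - \<alpha>\<^sup>2) * (norm g)\<^sup>2 + (norm (G y))\<^sup>2 \<le> 2 * (g \<bullet> G y)"
    by (simp add: power2_norm_eq_inner inner_diff_left inner_diff_right inner_commute algebra_simps)
  then have "h / 2 * ((1 - \<alpha>\<^sup>2) * (norm g)\<^sup>2 + (norm (G y))\<^sup>2) \<le> h / 2 * (2 * (g \<bullet> G y))"
    using h0 by (intro mult_left_mono) auto
  moreover have "(h / 2) * (L * h) * (norm (G y))\<^sup>2 \<le> (h / 2) * 1 * (norm (G y))\<^sup>2"
    using hb h0 by (intro mult_right_mono mult_left_mono) auto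
  ultimately have 2: "f (y - h *\<^sub>R G y) \<le> f y - h / 2 * (1 - \<alpha>\<^sup>2) * (norm g)\<^sup>2"
    using 1 by (simp add: algebra_simps diff_divide_distrib power2_eq_square)
  \<comment> \<open>This identity shows where \<open>re_agm_Lhat\<close> comes from: it is
    \<open>L\<close> corrected by the lower bound for \<open>L * h\<close> and by the factor
    \<open>1 - \<alpha>\<^sup>2\<close>.\<close>
  have "1 / (2 * re_agm_Lhat L \<alpha>) = ((1 - \<alpha>) / (1 + \<alpha>))\<^sup>2 * (1 - \<alpha>\<^sup>2) / (2 * L)"
    using L a by (simp add: re_agm_Lhat_def divide_simps) (simp add: power2_eq_square power3_eq_cube algebra_simps)
  also have "\<dots> \<le> (L * h) * (1 - \<alpha>\<^sup>2) / (2 * L)"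
    using L a hb by (intro divide_right_mono mult_right_mono) (auto simp: power_le_one)
  also have "\<dots> = h / 2 * (1 - \<alpha>\<^sup>2)" using L by simp
  finally have "1 / (2 * re_agm_Lhat L \<alpha>) * (norm g)\<^sup>2 \<le> h / 2 * (1 - \<alpha>\<^sup>2) * (norm g)\<^sup>2"
    by (rule mult_right_mono) simp
  then show ?thesis using 2 by (simp add: h_def g_def)
qed

section \<open>Contraction of the energy in one step\<close>

text \<open>Expanding the new distance to \<open>z\<close> produces \<open>g \<bullet> w\<close> and
  \<open>g \<bullet> d\<close>, which convexity turns into the differences of \<open>f\<close> from
  \<open>y\<close> to \<open>z\<close> and from \<open>y\<close> to \<open>x\<close>. In the
  application \<open>q / \<mu>\<close> is \<open>1 / (2 * re_agm_Lhat L \<alpha>)\<close>.\<close>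

lemma accelerated_step_contraction:
  fixes f :: "'a::real_inner \<Rightarrow> real" and gradf G :: "'a \<Rightarrow> 'a" and x u z :: 'a
  assumes \<mu>: "0 < \<mu>" and a: "0 < a" "a \<le> 1" and \<alpha>: "0 \<le> \<alpha>"
    and f: "smooth_strongly_convex L \<mu> f gradf" and G: "relative_error_gradient \<alpha> gradf G"
    and y: "y = (a *\<^sub>R u + x) /\<^sub>R (1 + a)"
    and u': "u' = (1 - a) *\<^sub>R u + a *\<^sub>R y - (a / (\<mu> / 2)) *\<^sub>R G y"
    and dec: "f x' \<le> f y - q / \<mu> * (norm (gradf y))\<^sup>2"
    and q: "a\<^sup>2 * (1 + \<alpha>)\<^sup>2 + 2 * a * \<alpha>\<^sup>2 \<le> q"
  shows "f x' - f z + \<mu> / 4 * (norm (u' - z))\<^sup>2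
          \<le> (1 - a) * (f x - f z + \<mu> / 4 * (norm (u - z))\<^sup>2)"
proof -
  define w d g e where "w = y - z" "d = u - y" "g = gradf y" "e = G y - gradf y"
  note defs = this
  have err: "norm e \<le> \<alpha> * norm g"
    using G unfolding relative_error_gradient_def defs by blast
  have "(1 + a) *\<^sub>R y = a *\<^sub>R u + x" using y a by simp
  \<comment> \<open>The choice of \<open>y\<close> makes \<open>u - y\<close> parallel to
    \<open>y - x\<close>, so that \<open>g \<bullet> d\<close> can be compared with values of
    \<open>f\<close>.\<close>
  then have yx: "a *\<^sub>R d = y - x" by (simp add: defs algebra_simps)
  have ineq: "f y + g \<bullet> (p - y) + \<mu> / 2 * (norm (p - y))\<^sup>2 \<le> f p" for p
    using f unfolding smooth_strongly_convex_def defs by (smt (verit, ccfv_SIG))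
  have gw: "f y - f z + \<mu> / 2 * (norm w)\<^sup>2 \<le> g \<bullet> w"
    using ineq[of z] by (simp add: defs inner_diff_right norm_minus_commute)
  have gd: "f y - f x \<le> a * (g \<bullet> d)"
  proof -
    have "a * (g \<bullet> d) = g \<bullet> (y - x)" by (metis inner_scaleR_right yx)
    moreover have "0 \<le> \<mu> / 2 * (norm (x - y))\<^sup>2" using \<mu> by simp
    ultimately show ?thesis using ineq[of x] by (simp add: inner_diff_right)
  qed
  have u'z: "u' - z = (w + (1 - a) *\<^sub>R d) - (2 * a / \<mu>) *\<^sub>R G y"
    by (simp add: u' defs algebra_simps)
  \<comment> \<open>The weight \<open>\<mu> / 4\<close> and the step \<open>2 * a / \<mu>\<close>
    combine to the coefficient \<open>a\<close> of the cross term.\<close>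
  have sq: "\<mu> / 4 * (norm (p - (2 * a / \<mu>) *\<^sub>R r))\<^sup>2 =
      \<mu> / 4 * (norm p)\<^sup>2 - a * (r \<bullet> p) + a\<^sup>2 / \<mu> * (norm r)\<^sup>2" for p r :: 'a
    unfolding power2_norm_eq_inner using \<mu>
    by (simp add: inner_diff_left inner_diff_right inner_commute[of p r] field_simps power2_eq_square)
  \<comment> \<open>The vector is the convex combination of \<open>u - z\<close> and
    \<open>w\<close> with weights \<open>1 - a\<close> and \<open>a\<close>; their difference is
    \<open>d\<close>.\<close>
  have convex: "(norm (w + (1 - a) *\<^sub>R d))\<^sup>2 =
      (1 - a) * (norm (u - z))\<^sup>2 + a * (norm w)\<^sup>2 - a * (1 - a) * (norm d)\<^sup>2"
  proof -
    have "u - z = w + d" by (simp add: defs)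
    then show ?thesis unfolding power2_norm_eq_inner
      by (simp add: inner_add_left inner_add_right inner_commute[of d w] algebra_simps)
  qed
  have Gy: "(norm (G y))\<^sup>2 \<le> (1 + \<alpha>)\<^sup>2 * (norm g)\<^sup>2"
  proof -
    have "norm (G y) \<le> norm g + norm e"
      using norm_triangle_ineq[of g e] by (simp add: defs)
    also have "\<dots> \<le> (1 + \<alpha>) * norm g" using err by (simp add: algebra_simps)
    finally show ?thesis by (metis norm_ge_zero power_mono power_mult_distrib)
  qed
  have split: "G y \<bullet> (w + (1 - a) *\<^sub>R d) = g \<bullet> w + e \<bullet> w + (1 - a) * (g \<bullet> d) + (1 - a) * (e \<bullet> d)"
    by (simp add: defs inner_diff_left inner_add_right algebra_simps)
  have E1: "a * - (e \<bullet> w) \<le> a * (\<mu> / 4 * (norm w)\<^sup>2 + \<alpha>\<^sup>2 / \<mu> * (norm g)\<^sup>2)"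
    using a inner_error_bound[OF \<mu> err] by (intro mult_left_mono) auto
  have E2: "a * (1 - a) * - (e \<bullet> d) \<le> a * (1 - a) * (\<mu> / 4 * (norm d)\<^sup>2 + \<alpha>\<^sup>2 / \<mu> * (norm g)\<^sup>2)"
    using a inner_error_bound[OF \<mu> err] by (intro mult_left_mono) auto
  have E3: "a * (f y - f z + \<mu> / 2 * (norm w)\<^sup>2) \<le> a * (g \<bullet> w)"
    using a gw by (intro mult_left_mono) auto
  have E4: "(1 - a) * (f y - f x) \<le> (1 - a) * (a * (g \<bullet> d))"
    using a gd by (intro mult_left_mono) auto
  have E5: "a\<^sup>2 / \<mu> * (norm (G y))\<^sup>2 \<le> a\<^sup>2 / \<mu> * ((1 + \<alpha>)\<^sup>2 * (norm g)\<^sup>2)"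
    using \<mu> Gy by (intro mult_left_mono) auto
  have E6: "a\<^sup>2 / \<mu> * ((1 + \<alpha>)\<^sup>2 * (norm g)\<^sup>2) + 2 * a * (\<alpha>\<^sup>2 / \<mu> * (norm g)\<^sup>2) \<le> q / \<mu> * (norm g)\<^sup>2"
  proof -
    have "(a\<^sup>2 * (1 + \<alpha>)\<^sup>2 + 2 * a * \<alpha>\<^sup>2) * ((norm g)\<^sup>2 / \<mu>) \<le> q * ((norm g)\<^sup>2 / \<mu>)"
      using q \<mu> by (intro mult_right_mono) auto
    then show ?thesis by (simp add: algebra_simps add_divide_distrib)
  qed
  \<comment> \<open>The error terms of \<open>E1\<close> and \<open>E2\<close> carry the factor
    \<open>a + a * (1 - a)\<close>, while \<open>E6\<close> charges \<open>2 * a\<close>; this is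
    the difference.\<close>
  have E7: "0 \<le> a * a * (\<alpha>\<^sup>2 / \<mu> * (norm g)\<^sup>2)" using \<mu> by simp
  have "\<mu> / 4 * (norm (u' - z))\<^sup>2 =
      (1 - a) * (\<mu> / 4 * (norm (u - z))\<^sup>2) + a * (\<mu> / 4 * (norm w)\<^sup>2) - a * (1 - a) * (\<mu> / 4 * (norm d)\<^sup>2)
      - a * (g \<bullet> w) - a * (e \<bullet> w) - (1 - a) * (a * (g \<bullet> d)) - a * (1 - a) * (e \<bullet> d)
      + a\<^sup>2 / \<mu> * (norm (G y))\<^sup>2"
    unfolding u'z sq split convex by (simp add: algebra_simps diff_divide_distrib)
  \<comment> \<open>The quadratic terms cancel: \<open>w\<close> collects \<open>\<mu> / 4\<close>
    from \<open>convex\<close> and from \<open>E1\<close> against \<open>\<mu> / 2\<close> in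
    \<open>E3\<close>, and \<open>d\<close> collects \<open>\<mu> / 4\<close> in \<open>E2\<close>
    against the negative term of \<open>convex\<close>.\<close>
  also have "\<dots> \<le> (1 - a) * (\<mu> / 4 * (norm (u - z))\<^sup>2) + q / \<mu> * (norm g)\<^sup>2
      - a * (f y - f z) - (1 - a) * (f y - f x)"
    using E1 E2 E3 E4 E5 E6 E7 by (simp add: algebra_simps diff_divide_distrib)
  finally show ?thesis using dec by (simp add: defs algebra_simps)
qed

section \<open>Estimates for the parameter \<open>a\<close>\<close>

text \<open>Here \<open>s - m = 4 * \<alpha> + 2 * \<alpha>\<^sup>2\<close>. The quadratic increases
  on nonnegative arguments, so a lower bound for the root only requires testing a candidate
  \<open>c\<close>.\<close>

lemma re_agm_a_root:
  assumes "0 < L" "0 < b" "0 \<le> \<alpha>" "\<alpha> < 1 / 2"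
  shows "(1 - 2 * \<alpha>) * (re_agm_a L b \<alpha>)\<^sup>2 + (4 * \<alpha> + 2 * \<alpha>\<^sup>2) * re_agm_a L b \<alpha> = b / re_agm_Lhat L \<alpha>"
    and "c \<ge> 0 \<Longrightarrow> (1 - 2 * \<alpha>) * c\<^sup>2 + (4 * \<alpha> + 2 * \<alpha>\<^sup>2) * c \<le> b / re_agm_Lhat L \<alpha> \<Longrightarrow> c \<le> re_agm_a L b \<alpha>"
proof -
  define m p q where "m = 1 - 2 * \<alpha>" "p = 4 * \<alpha> + 2 * \<alpha>\<^sup>2" "q = b / re_agm_Lhat L \<alpha>"
  note defs = this
  have m: "0 < m" and p: "0 \<le> p" and q: "0 \<le> q"
    using assms by (auto simp: defs re_agm_Lhat_def)
  define S where "S = sqrt (p\<^sup>2 + 4 * m * q)"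
  have S: "S\<^sup>2 = p\<^sup>2 + 4 * m * q" using m q by (simp add: S_def)
  have "re_agm_a L b \<alpha> = (- p + sqrt (p\<^sup>2 + 4 * m * q)) / (2 * m)"
    unfolding re_agm_a_def Let_def defs by (simp add: algebra_simps)
  then have a: "re_agm_a L b \<alpha> = (S - p) / (2 * m)" by (simp add: S_def)
  have "m * ((S - p) / (2 * m))\<^sup>2 + p * ((S - p) / (2 * m)) = (S\<^sup>2 - p\<^sup>2) / (4 * m)"
    using m by (simp add: field_simps power2_eq_square)
  then show "(1 - 2 * \<alpha>) * (re_agm_a L b \<alpha>)\<^sup>2 + (4 * \<alpha> + 2 * \<alpha>\<^sup>2) * re_agm_a L b \<alpha> = b / re_agm_Lhat L \<alpha>"
    using m S unfolding a by (simp add: defs)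
  assume c: "c \<ge> 0" "(1 - 2 * \<alpha>) * c\<^sup>2 + (4 * \<alpha> + 2 * \<alpha>\<^sup>2) * c \<le> b / re_agm_Lhat L \<alpha>"
  then have "4 * m * (m * c\<^sup>2 + p * c) \<le> 4 * m * q"
    using m by (intro mult_left_mono) (auto simp: defs)
  \<comment> \<open>Completing the square avoids a monotonicity argument.\<close>
  then have "(2 * m * c + p)\<^sup>2 \<le> p\<^sup>2 + 4 * m * q"
    by (simp add: power2_eq_square algebra_simps)
  then have "2 * m * c + p \<le> S" unfolding S_def by (rule real_le_rsqrt)
  then show "c \<le> re_agm_a L b \<alpha>" unfolding a using m by (simp add: field_simps)
qed

text \<open>With \<open>r = sqrt (\<mu> / L)\<close>, the right-hand side \<open>q\<close> of the
  quadratic lies between \<open>r\<^sup>2 / 4\<close> and \<open>1 / 2\<close>, and \<alpha> is at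
  most \<open>r / 50\<close>. The candidate \<open>c\<close> is thus below the root, and values
  above \<open>9 / 10\<close> overshoot \<open>q\<close>.\<close>

lemma re_agm_a_bounds:
  assumes \<mu>: "0 < \<mu>" "\<mu> \<le> L" and \<alpha>0: "0 \<le> \<alpha>"
    and \<alpha>: "\<alpha> < (sqrt 2 - 1) / (18 * sqrt 2) * sqrt (\<mu> / L)"
  shows "1 / (10 * sqrt 2) * sqrt (\<mu> / L) \<le> re_agm_a L (\<mu> / 2) \<alpha>"
    and "re_agm_a L (\<mu> / 2) \<alpha> \<le> 9 / 10" and "\<alpha> \<le> 1 / 50"
proof -
  define r where "r = sqrt (\<mu> / L)"
  have r: "0 < r" "r \<le> 1" "r\<^sup>2 = \<mu> / L" using \<mu> by (auto simp: r_def)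
  have s2: "7 / 5 \<le> sqrt 2" "sqrt 2 \<le> 3 / 2"
    by (rule real_le_rsqrt real_le_lsqrt; simp add: power2_eq_square)+
  have "(sqrt 2 - 1) / (18 * sqrt 2) \<le> 1 / 50"
    using s2 by (simp add: field_simps)
  then have "(sqrt 2 - 1) / (18 * sqrt 2) * r \<le> 1 / 50 * r"
    using r by (intro mult_right_mono) auto
  then have \<alpha>r: "\<alpha> \<le> r / 50" using \<alpha> unfolding r_def by linarith
  then show \<alpha>50: "\<alpha> \<le> 1 / 50" using r by linarith
  define q where "q = (\<mu> / 2) / re_agm_Lhat L \<alpha>"
  define c where "c = 1 / (10 * sqrt 2) * r"
  \<comment> \<open>This is the ratio of \<open>L\<close> to \<open>re_agm_Lhat L \<alpha>\<close>,
    close to 1 for small \<alpha>.\<close>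
  define \<kappa> where "\<kappa> = (1 - \<alpha>) ^ 3 / (1 + \<alpha>)"
  have q_eq: "q = r\<^sup>2 / 2 * \<kappa>"
    unfolding q_def r re_agm_Lhat_def \<kappa>_def by simp
  have \<kappa>: "1 / 2 \<le> \<kappa>" "\<kappa> \<le> 1"
  proof -
    have "(49 / 50) ^ 3 \<le> (1 - \<alpha>) ^ 3" using \<alpha>50 by (intro power_mono) auto
    then have "1 / 2 * (1 + \<alpha>) \<le> (1 - \<alpha>) ^ 3" using \<alpha>50 by (simp add: power3_eq_cube)
    then show "1 / 2 \<le> \<kappa>" using \<alpha>0 by (simp add: \<kappa>_def field_simps)
    have "(1 - \<alpha>) ^ 3 \<le> 1" using \<alpha>0 \<alpha>50 by (intro power_le_one) auto
    then show "\<kappa> \<le> 1" using \<alpha>0 by (simp add: \<kappa>_def)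
  qed
  have c: "0 \<le> c" "c \<le> r / 10"
  proof -
    show "0 \<le> c" using r by (simp add: c_def)
    have "1 / (10 * sqrt 2) \<le> 1 / 10" by simp
    then show "c \<le> r / 10" unfolding c_def using r mult_right_mono[of "1 / (10 * sqrt 2)" "1 / 10" r] by simp
  qed
  \<comment> \<open>The bound amounts to \<open>3 * r\<^sup>2 / 100\<close>, well below
    \<open>r\<^sup>2 / 4\<close>.\<close>
  have "(1 - 2 * \<alpha>) * c\<^sup>2 + (4 * \<alpha> + 2 * \<alpha>\<^sup>2) * c \<le> 1 * (r / 10)\<^sup>2 + (r / 5) * (r / 10)"
  proof (intro add_mono mult_mono)
    have "\<alpha>\<^sup>2 \<le> \<alpha>" using \<alpha>0 \<alpha>50 by (simp add: power2_eq_square mult_left_le)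
    then show "4 * \<alpha> + 2 * \<alpha>\<^sup>2 \<le> r / 5" using \<alpha>r r by linarith
  qed (use c \<alpha>0 \<alpha>50 r in auto)
  also have "\<dots> \<le> r\<^sup>2 / 2 * (1 / 2)" by (simp add: power2_eq_square)
  also have "\<dots> \<le> q" unfolding q_eq using \<kappa> by (intro mult_left_mono) auto
  finally show "1 / (10 * sqrt 2) * sqrt (\<mu> / L) \<le> re_agm_a L (\<mu> / 2) \<alpha>"
    using re_agm_a_root(2)[of L "\<mu> / 2" \<alpha> c] \<mu> \<alpha>0 \<alpha>50 c by (simp add: q_def c_def r_def)
  then have a0: "0 \<le> re_agm_a L (\<mu> / 2) \<alpha>" using c(1) by (simp add: c_def r_def)
  show "re_agm_a L (\<mu> / 2) \<alpha> \<le> 9 / 10"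
  proof (rule ccontr)
    assume "\<not> ?thesis"
    then have "(9 / 10)\<^sup>2 \<le> (re_agm_a L (\<mu> / 2) \<alpha>)\<^sup>2" by (intro power_mono) auto
    then have "48 / 50 * (9 / 10)\<^sup>2 \<le> (1 - 2 * \<alpha>) * (re_agm_a L (\<mu> / 2) \<alpha>)\<^sup>2"
      using \<alpha>50 by (intro mult_mono) auto
    moreover have "0 \<le> (4 * \<alpha> + 2 * \<alpha>\<^sup>2) * re_agm_a L (\<mu> / 2) \<alpha>" using \<alpha>0 a0 by simp
    moreover have "q \<le> 1 / 2 * 1"
      unfolding q_eq using \<kappa> r(1) power_le_one[of r 2] r(2) by (intro mult_mono) linarith+
    ultimately show False
      using re_agm_a_root(1)[of L "\<mu> / 2" \<alpha>] \<mu> \<alpha>0 \<alpha>50 by (simp add: q_def power2_eq_square)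
  qed
qed

text \<open>After inserting the quadratic equation, the claim reduces to
  \<open>c * (4 + \<alpha>) \<le> 4\<close> times \<open>\<alpha> * c\<close>; the bounds on
  \<alpha> and \<open>a\<close> give 3.618 on the left.\<close>

lemma re_agm_a_error_budget:
  assumes "0 < L" "0 < b" "0 \<le> \<alpha>" "\<alpha> \<le> 1 / 50"
    and a: "0 \<le> re_agm_a L b \<alpha>" "re_agm_a L b \<alpha> \<le> 9 / 10"
  shows "(re_agm_a L b \<alpha>)\<^sup>2 * (1 + \<alpha>)\<^sup>2 + 2 * re_agm_a L b \<alpha> * \<alpha>\<^sup>2 \<le> b / re_agm_Lhat L \<alpha>"
proof -
  define c where "c = re_agm_a L b \<alpha>"
  have "c * (4 + \<alpha>) \<le> 9 / 10 * (4 + 1 / 50)"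
    using assms by (intro mult_mono) (auto simp: c_def)
  then have "\<alpha> * c * (c * (4 + \<alpha>)) \<le> \<alpha> * c * 4"
    using assms by (intro mult_left_mono) (auto simp: c_def)
  then have "c\<^sup>2 * (1 + \<alpha>)\<^sup>2 + 2 * c * \<alpha>\<^sup>2 \<le> (1 - 2 * \<alpha>) * c\<^sup>2 + (4 * \<alpha> + 2 * \<alpha>\<^sup>2) * c"
    by (simp add: power2_eq_square algebra_simps)
  then show ?thesis using re_agm_a_root(1)[of L b \<alpha>] assms by (simp add: c_def)
qed

section \<open>The convergence rate\<close>

theorem theorem4:
  fixes f :: "real ^ 'd \<Rightarrow> real"
    and gradf G :: "real ^ 'd \<Rightarrow> real ^ 'd"
    and L \<mu> \<alpha> :: real
    and xstar x0 :: "real ^ 'd"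
    and N :: nat
  assumes "0 < \<mu>" and "\<mu> \<le> L"
    and "has_continuous_gradient f gradf"
    and "smooth_strongly_convex L \<mu> f gradf"
    and "\<forall>x. f xstar \<le> f x"
    and "0 \<le> \<alpha>" and "\<alpha> < 1"
    and "\<alpha> < (sqrt 2 - 1) / (18 * sqrt 2) * sqrt (\<mu> / L)"
    and "relative_error_gradient \<alpha> gradf G"
  shows "f (re_agm_x L (\<mu> / 2) x0 \<alpha> G N) - f xstar
           \<le> L * (norm (x0 - xstar))\<^sup>2 * (1 - 1 / (10 * sqrt 2) * sqrt (\<mu> / L)) ^ N"
proof -
  define a where "a = re_agm_a L (\<mu> / 2) \<alpha>"
  define c where "c = 1 / (10 * sqrt 2) * sqrt (\<mu> / L)"
  have L: "0 < L" using assms(1,2) by linarith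
  note ab = re_agm_a_bounds[OF assms(1,2,6,8), folded a_def c_def]
  have "0 < c" using assms(1) L by (simp add: c_def)
  then have a: "0 < a" "a \<le> 1" "1 - a \<le> 1 - c" using ab by auto
  have budget: "a\<^sup>2 * (1 + \<alpha>)\<^sup>2 + 2 * a * \<alpha>\<^sup>2 \<le> \<mu> / 2 / re_agm_Lhat L \<alpha>"
    using re_agm_a_error_budget[of L "\<mu> / 2" \<alpha>] L assms(1,6) ab a by (simp add: a_def)
  define X where "X k = fst (re_agm L (\<mu> / 2) x0 \<alpha> G k)" for k
  define U where "U k = snd (re_agm L (\<mu> / 2) x0 \<alpha> G k)" for k
  define V where "V k = f (X k) - f xstar + \<mu> / 4 * (norm (U k - xstar))\<^sup>2" for k
  have V_Suc: "V (Suc k) \<le> (1 - a) * V k" for k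
  proof -
    define y where "y = (a *\<^sub>R U k + X k) /\<^sub>R (1 + a)"
    have "re_agm L (\<mu> / 2) x0 \<alpha> G k = (X k, U k)" by (simp add: X_def U_def)
    then have XU: "X (Suc k) = y - re_agm_h L \<alpha> *\<^sub>R G y"
      "U (Suc k) = (1 - a) *\<^sub>R U k + a *\<^sub>R y - (a / (\<mu> / 2)) *\<^sub>R G y"
      by (simp_all add: X_def[of "Suc k"] U_def[of "Suc k"] re_agm_step_def Let_def a_def[symmetric] y_def)
    have "f (X (Suc k)) \<le> f y - (\<mu> / 2 / re_agm_Lhat L \<alpha>) / \<mu> * (norm (gradf y))\<^sup>2"
      using inexact_gradient_step_decrease[OF L assms(6,7,4,9), of y] assms(1) by (simp add: XU)
    from accelerated_step_contraction[OF assms(1) a(1,2) assms(6,4,9) y_def XU(2) this budget]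
    show ?thesis unfolding V_def .
  qed
  have V_pow: "V k \<le> (1 - a) ^ k * V 0" for k
  proof (induction k)
    case (Suc k)
    have "V (Suc k) \<le> (1 - a) * ((1 - a) ^ k * V 0)"
      using V_Suc[of k] Suc a mult_left_mono[of "V k" "(1 - a) ^ k * V 0" "1 - a"] by linarith
    then show ?case by simp
  qed simp
  \<comment> \<open>Both sequences start at \<open>x0\<close>: smoothness at the minimizer
    contributes \<open>L / 2\<close> and the distance term \<open>\<mu> / 4\<close>, at most
    \<open>3 * L / 4\<close> together.\<close>
  have V0: "V 0 \<le> L * (norm (x0 - xstar))\<^sup>2"
  proof -
    have "f x0 - f xstar - gradf xstar \<bullet> (x0 - xstar) \<le> L / 2 * (norm (x0 - xstar))\<^sup>2"
      using assms(4) unfolding smooth_strongly_convex_def by blast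
    then have "V 0 \<le> (L / 2 + \<mu> / 4) * (norm (x0 - xstar))\<^sup>2"
      by (simp add: V_def X_def U_def gradient_zero_at_minimizer[OF L assms(4,5)] algebra_simps)
    also have "\<dots> \<le> L * (norm (x0 - xstar))\<^sup>2"
      using assms(1,2) by (intro mult_right_mono) auto
    finally show ?thesis .
  qed
  have "f (X N) - f xstar \<le> V N" using assms(1) by (simp add: V_def)
  also have "\<dots> \<le> (1 - a) ^ N * V 0" by (rule V_pow)
  also have "\<dots> \<le> (1 - a) ^ N * (L * (norm (x0 - xstar))\<^sup>2)"
    using V0 a by (intro mult_left_mono) auto
  also have "\<dots> \<le> (1 - c) ^ N * (L * (norm (x0 - xstar))\<^sup>2)"
    using L a by (intro mult_right_mono power_mono) auto
  finally show ?thesis by (simp add: X_def re_agm_x_def c_def mult.commute)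
qed

end
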